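(* Let $f$ be as in the context. The sequences $\{x_k\}_{k=0}^\infty$, $\{\phi_k(x)\}_{k=0}^\infty$ and $\{\alpha_k\}_{k=0}^\infty$ generated by the algorithm ASUESA (described in the context), from any initial point $x_0\in\mathbb{R}^n$, form an Underestimate Sequence (UES) of $f$, so ASUESA converges at the (optimal) linear rate: for all $k\ge0$, $$f(x_k)-\phi_k^*\le\left(1-\sqrt{\tfrac{\mu}{L}}\right)^k(f(x_0)-\phi_0^* ).$$
   Context: Setting (smooth case): $f:\mathbb{R}^n\to\mathbb{R}$ is continuously differentiable, $\mu$-strongly convex and $L$-smooth with $L>\mu>0$, i.e. for all $x,y\in\mathbb{R}^n$ (Euclidean norm): $f(x)\ge f(y)+\langle\nabla f(y),x-y\rangle+\frac{\mu}{2}\|x-y\|^2$ and $f(x)\le f(y)+\langle\nabla f(y),x-y\rangle+\frac{L}{2}\|x-y\|^2$. For a point $y$: $y^{++}:=y-\frac1\mu\nabla f(y)$. For $x,y\in\mathbb{R}^n$ put $\phi(x;y):=f(y)-\frac{1}{2\mu}\|\nabla f(y)\|^2+\frac{\mu}{2}\|x-y^{++}\|^2$. Algorithm ASUESA (run without its stopping test, so that infinite sequences are produced): given $x_0$, set $\alpha_k=\sqrt{\mu/L}$ and $\beta_k=\frac{1}{1+\alpha_k}$ for all $k\ge0$, $v_0=x_0^{++}$ and $\phi_0(x):=\phi(x;x_0)$. For $k=0,1,2,\dots$: set $y_k=\beta_k x_k+(1-\beta_k)v_k$; $x_{k+1}=y_k-\frac1L\nabla f(y_k)$; $v_{k+1}=(1-\alpha_k)v_k+\alpha_k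 y_k^{++}$; $\phi_{k+1}(x):=(1-\alpha_k)\phi_k(x)+\alpha_k\phi(x;y_k)$. Throughout, $\phi_k^*:=\min_x\phi_k(x)$. Definition (UES). A series of sequences $\{x_k\}_{k=0}^\infty\subset\mathbb{R}^n$, $\{\phi_k(x)\}_{k=0}^\infty$ (real-valued functions on $\mathbb{R}^n$, each attaining its minimum) and $\{\alpha_k\}_{k=0}^\infty$ with $\alpha_k\in(0,1)$ for all $k\ge0$ is called an Underestimate Sequence (UES) of a function $F:\mathbb{R}^n\to\mathbb{R}$ if for all $x\in\mathbb{R}^n$ and all $k\ge0$: (i) $\phi_k(x)\le F(x)$; and (ii) $F(x_{k+1})-\phi_{k+1}^*\le(1-\alpha_k)(F(x_k)-\phi_k^* )$, where $\phi_k^*:=\min_x\phi_k(x)$. Here $F=f$. *)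

theory Defs
  imports "HOL-Analysis.Analysis"
begin

text \<open>
  Throughout, \<open>g\<close> is the gradient map of \<open>f\<close>; theorems state this with
  the library's \<open>GDERIV f y :> g y\<close>.
\<close>

definition long_step :: "('a::real_inner \<Rightarrow> 'a) \<Rightarrow> real \<Rightarrow> 'a \<Rightarrow> 'a" where
  "long_step g \<mu> y = y - (1 / \<mu>) *\<^sub>R g y"

definition lower_model ::
  "('a::real_inner \<Rightarrow> real) \<Rightarrow> ('a \<Rightarrow> 'a) \<Rightarrow> real \<Rightarrow> 'a \<Rightarrow> 'a \<Rightarrow> real" where
  "lower_model f g \<mu> x y =
     f y - (1 / (2 * \<mu>)) * (norm (g y))\<^sup>2 + (\<mu> / 2) * (norm (x - long_step g \<mu> y))\<^sup>2"

definition asuesa_alpha :: "real \<Rightarrow> real \<Rightarrow> nat \<Rightarrow> real" where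
  "asuesa_alpha \<mu> L k = sqrt (\<mu> / L)"

definition asuesa_beta :: "real \<Rightarrow> real \<Rightarrow> nat \<Rightarrow> real" where
  "asuesa_beta \<mu> L k = 1 / (1 + asuesa_alpha \<mu> L k)"

text \<open>The pair \<open>(x\<^sub>k, v\<^sub>k)\<close>; the bound \<open>y\<close> is the extrapolated point \<open>y\<^sub>k\<close>.\<close>

primrec asuesa_xv ::
  "('a::real_inner \<Rightarrow> 'a) \<Rightarrow> real \<Rightarrow> real \<Rightarrow> 'a \<Rightarrow> nat \<Rightarrow> 'a \<times> 'a" where
  "asuesa_xv g \<mu> L x0 0 = (x0, long_step g \<mu> x0)"
| "asuesa_xv g \<mu> L x0 (Suc k) =
     (let (x, v) = asuesa_xv g \<mu> L x0 k;
          \<alpha> = asuesa_alpha \<mu> L k;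
          \<beta> = asuesa_beta \<mu> L k;
          y = \<beta> *\<^sub>R x + (1 - \<beta>) *\<^sub>R v
      in (y - (1 / L) *\<^sub>R g y, (1 - \<alpha>) *\<^sub>R v + \<alpha> *\<^sub>R long_step g \<mu> y))"

definition asuesa_x :: "('a::real_inner \<Rightarrow> 'a) \<Rightarrow> real \<Rightarrow> real \<Rightarrow> 'a \<Rightarrow> nat \<Rightarrow> 'a" where
  "asuesa_x g \<mu> L x0 k = fst (asuesa_xv g \<mu> L x0 k)"

definition asuesa_v :: "('a::real_inner \<Rightarrow> 'a) \<Rightarrow> real \<Rightarrow> real \<Rightarrow> 'a \<Rightarrow> nat \<Rightarrow> 'a" where
  "asuesa_v g \<mu> L x0 k = snd (asuesa_xv g \<mu> L x0 k)"

definition asuesa_y :: "('a::real_inner \<Rightarrow> 'a) \<Rightarrow> real \<Rightarrow> real \<Rightarrow> 'a \<Rightarrow> nat \<Rightarrow> 'a" where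
  "asuesa_y g \<mu> L x0 k =
     asuesa_beta \<mu> L k *\<^sub>R asuesa_x g \<mu> L x0 k
     + (1 - asuesa_beta \<mu> L k) *\<^sub>R asuesa_v g \<mu> L x0 k"

primrec asuesa_phi ::
  "('a::real_inner \<Rightarrow> real) \<Rightarrow> ('a \<Rightarrow> 'a) \<Rightarrow> real \<Rightarrow> real \<Rightarrow> 'a \<Rightarrow> nat \<Rightarrow> 'a \<Rightarrow> real" where
  "asuesa_phi f g \<mu> L x0 0 = (\<lambda>x. lower_model f g \<mu> x x0)"
| "asuesa_phi f g \<mu> L x0 (Suc k) =
     (\<lambda>x. (1 - asuesa_alpha \<mu> L k) * asuesa_phi f g \<mu> L x0 k x
          + asuesa_alpha \<mu> L k * lower_model f g \<mu> x (asuesa_y g \<mu> L x0 k))"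

lemma asuesa_x_0: "asuesa_x g \<mu> L x0 0 = x0"
  and asuesa_v_0: "asuesa_v g \<mu> L x0 0 = long_step g \<mu> x0"
  by (simp_all add: asuesa_x_def asuesa_v_def)

lemma asuesa_x_Suc:
    "asuesa_x g \<mu> L x0 (Suc k) =
       asuesa_y g \<mu> L x0 k - (1 / L) *\<^sub>R g (asuesa_y g \<mu> L x0 k)"
  and asuesa_v_Suc:
    "asuesa_v g \<mu> L x0 (Suc k) =
       (1 - asuesa_alpha \<mu> L k) *\<^sub>R asuesa_v g \<mu> L x0 k
       + asuesa_alpha \<mu> L k *\<^sub>R long_step g \<mu> (asuesa_y g \<mu> L x0 k)"
  by (simp_all add: asuesa_x_def asuesa_v_def asuesa_y_def Let_def split_beta)

definition attains_min :: "('a \<Rightarrow> real) \<Rightarrow> bool" where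
  "attains_min h \<longleftrightarrow> (\<exists>z. \<forall>x. h z \<le> h x)"

text \<open>\<open>arg_min\<close> picks an arbitrary minimiser, so this is the minimum of \<open>h\<close> only
  if \<open>attains_min h\<close>; otherwise the value is unspecified.\<close>

definition min_value :: "('a \<Rightarrow> real) \<Rightarrow> real" where
  "min_value h = h (arg_min h (\<lambda>_. True))"

definition underestimate_sequence ::
  "('a \<Rightarrow> real) \<Rightarrow> (nat \<Rightarrow> 'a) \<Rightarrow> (nat \<Rightarrow> 'a \<Rightarrow> real) \<Rightarrow> (nat \<Rightarrow> real) \<Rightarrow> bool" where
  "underestimate_sequence F x \<phi> \<alpha> \<longleftrightarrow>
     (\<forall>k. attains_min (\<phi> k)) \<and>
     (\<forall>k. 0 < \<alpha> k \<and> \<alpha> k < 1) \<and>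
     (\<forall>k z. \<phi> k z \<le> F z) \<and>
     (\<forall>k. F (x (Suc k)) - min_value (\<phi> (Suc k)) \<le> (1 - \<alpha> k) * (F (x k) - min_value (\<phi> k)))"

end

theory Submission
  imports Defs
begin

text \<open>
  Each \<open>\<phi>\<^sub>k\<close> is a convex combination of lower models, and every lower model is a quadratic with
  Hessian \<open>\<mu> I\<close>.  Two consequences drive the proof.  First, \<open>\<phi>\<^sub>k \<le> f\<close>, because completing the
  square turns the strong convexity bound at \<open>y\<close> into the lower model at \<open>y\<close>.  Second, \<open>\<phi>\<^sub>k\<close>
  again has Hessian \<open>\<mu> I\<close>, and its centre is the average of the centres of the models, which
  is exactly how \<open>v\<^sub>k\<close> is updated; so \<open>\<phi>\<^sub>k\<^sup>* = \<phi>\<^sub>k(v\<^sub>k)\<close>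
  (\<open>asuesa_phi_eq_quadratic\<close>).

  Averaging two such quadratics raises the minimum above the average of the minima by
  \<open>\<mu>/2 \<alpha>(1 - \<alpha>)\<close> times the squared distance of the centres.  With \<open>y = y\<^sub>k\<close>,
  \<open>v = v\<^sub>k\<close> and centre \<open>y - \<nabla>f(y)/\<mu>\<close> of the new model, expanding that distance gives
    \<open>\<phi>\<^sub>k\<^sub>+\<^sub>1\<^sup>* \<ge> (1 - \<alpha>) \<phi>\<^sub>k\<^sup>* + \<alpha> f(y) - \<alpha>\<^sup>2/(2\<mu>) |\<nabla>f(y)|\<^sup>2 + \<alpha>(1 - \<alpha>) \<langle>\<nabla>f(y), v - y\<rangle>\<close>.
  On the other side the gradient step yields \<open>f(x\<^sub>k\<^sub>+\<^sub>1) \<le> f(y) - |\<nabla>f(y)|\<^sup>2/(2L)\<close>.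
  The choice \<open>\<alpha>\<^sup>2 = \<mu>/L\<close> makes the two \<open>|\<nabla>f(y)|\<^sup>2\<close> terms equal.  After the bound
  \<open>f(y) \<le> f(x\<^sub>k) - \<langle>\<nabla>f(y), x\<^sub>k - y\<rangle>\<close> the remaining inner products add up to a multiple of
  \<open>\<langle>\<nabla>f(y), (x\<^sub>k - y) + \<alpha>(v - y)\<rangle>\<close>, and \<open>\<beta> = 1/(1 + \<alpha>)\<close> is the weight for which this
  vector vanishes.  What is left is the one-step contraction (\<open>gap_contraction\<close>); iterating it
  gives the rate.
\<close>

lemma min_value_eqI:
  assumes "\<And>x. h z \<le> h x"
  shows "min_value h = h z"
proof -
  have "is_arg_min h (\<lambda>_. True) z"
    using assms by (simp add: is_arg_min_linorder)
  then have "is_arg_min h (\<lambda>_. True) (arg_min h (\<lambda>_. True))"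
    unfolding arg_min_def by (rule someI)
  then have "min_value h \<le> h z"
    by (simp add: min_value_def is_arg_min_linorder)
  then show ?thesis
    using assms[of "arg_min h (\<lambda>_. True)"] by (simp add: min_value_def)
qed

lemma average_of_squared_distances:
  fixes x v w :: "'a::real_inner"
  shows "(1 - a) * (norm (x - v))\<^sup>2 + a * (norm (x - w))\<^sup>2 =
    (norm (x - ((1 - a) *\<^sub>R v + a *\<^sub>R w)))\<^sup>2 + a * (1 - a) * (norm (v - w))\<^sup>2"
  by (simp add: power2_norm_eq_inner inner_simps inner_commute) (simp add: algebra_simps)

text \<open>
  Quadratics with equal curvature are closed under averaging, and the centre is averaged too.
  The term \<open>norm (v - w)\<close> is what averaging gains at the minimum; it pays for the
  gradient terms in \<open>gap_contraction\<close>.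
\<close>

lemma average_of_quadratics:
  fixes x v w :: "'a::real_inner"
  shows "(1 - a) * (p + h * (norm (x - v))\<^sup>2) + a * (q + h * (norm (x - w))\<^sup>2) =
    ((1 - a) * p + a * q + a * (1 - a) * (h * (norm (v - w))\<^sup>2))
    + h * (norm (x - ((1 - a) *\<^sub>R v + a *\<^sub>R w)))\<^sup>2"
proof -
  have "(1 - a) * (p + h * (norm (x - v))\<^sup>2) + a * (q + h * (norm (x - w))\<^sup>2) =
      (1 - a) * p + a * q + h * ((1 - a) * (norm (x - v))\<^sup>2 + a * (norm (x - w))\<^sup>2)"
    by (simp add: algebra_simps)
  then show ?thesis
    by (simp add: average_of_squared_distances distrib_left mult_ac)
qed

lemma norm_diff_long_step_squared:
  fixes x y :: "'a::real_inner"
  assumes "0 < \<mu>"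
  shows "(\<mu> / 2) * (norm (x - long_step g \<mu> y))\<^sup>2 =
    (\<mu> / 2) * (norm (x - y))\<^sup>2 + g y \<bullet> (x - y) + (1 / (2 * \<mu>)) * (norm (g y))\<^sup>2"
proof -
  have eq: "x - long_step g \<mu> y = (x - y) + (1 / \<mu>) *\<^sub>R g y"
    by (simp add: long_step_def)
  have "(norm (x - long_step g \<mu> y))\<^sup>2 =
      (norm (x - y))\<^sup>2 + (2 / \<mu>) * (g y \<bullet> (x - y)) + (1 / \<mu>)\<^sup>2 * (norm (g y))\<^sup>2"
    unfolding eq power2_norm_eq_inner inner_add_left inner_add_right
    by (simp add: inner_commute power2_eq_square)
  then show ?thesis
    using assms by (simp add: field_simps power2_eq_square)
qed

text \<open>
  Completing the square: the lower model is the strong convexity bound at \<open>y\<close>, written with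
  its minimum and its minimiser in evidence.
\<close>

lemma lower_model_eq_strong_convexity_bound:
  fixes x y :: "'a::real_inner"
  assumes "0 < \<mu>"
  shows "lower_model f g \<mu> x y = f y + g y \<bullet> (x - y) + (\<mu> / 2) * (norm (x - y))\<^sup>2"
  unfolding lower_model_def norm_diff_long_step_squared[OF assms] by simp

lemma asuesa_phi_le:
  fixes f :: "'a::real_inner \<Rightarrow> real"
  assumes "0 < \<mu>" "\<mu> \<le> L"
    and strongly_convex: "\<And>x y. f x \<ge> f y + g y \<bullet> (x - y) + (\<mu> / 2) * (norm (x - y))\<^sup>2"
  shows "asuesa_phi f g \<mu> L x0 k x \<le> f x"
proof (induction k)
  case 0
  show ?case
    using strongly_convex by (simp add: lower_model_eq_strong_convexity_bound \<open>0 < \<mu>\<close>)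
next
  case (Suc k)
  have model: "lower_model f g \<mu> x (asuesa_y g \<mu> L x0 k) \<le> f x"
    using strongly_convex by (simp add: lower_model_eq_strong_convexity_bound \<open>0 < \<mu>\<close>)
  have "0 \<le> asuesa_alpha \<mu> L k" "asuesa_alpha \<mu> L k \<le> 1"
    using assms(1,2) by (simp_all add: asuesa_alpha_def)
  then show ?case
    using convex_bound_le[OF Suc.IH model, of "1 - asuesa_alpha \<mu> L k" "asuesa_alpha \<mu> L k"]
    by simp
qed

lemma asuesa_phi_eq_quadratic:
  fixes f :: "'a::real_inner \<Rightarrow> real"
  shows "asuesa_phi f g \<mu> L x0 k x =
    asuesa_phi f g \<mu> L x0 k (asuesa_v g \<mu> L x0 k) + (\<mu> / 2) * (norm (x - asuesa_v g \<mu> L x0 k))\<^sup>2"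
proof (induction k arbitrary: x)
  case 0
  show ?case by (simp add: asuesa_v_0 lower_model_def)
next
  case (Suc k)
  define a where "a = asuesa_alpha \<mu> L k"
  define v where "v = asuesa_v g \<mu> L x0 k"
  define y where "y = asuesa_y g \<mu> L x0 k"
  define w where "w = long_step g \<mu> y"
  define c where "c = (1 - a) * asuesa_phi f g \<mu> L x0 k v + a * (f y - (1 / (2 * \<mu>)) * (norm (g y))\<^sup>2)
    + a * (1 - a) * ((\<mu> / 2) * (norm (v - w))\<^sup>2)"
  have v_Suc: "asuesa_v g \<mu> L x0 (Suc k) = (1 - a) *\<^sub>R v + a *\<^sub>R w"
    by (simp add: asuesa_v_Suc a_def v_def w_def y_def)
  have "asuesa_phi f g \<mu> L x0 (Suc k) z =
      c + (\<mu> / 2) * (norm (z - asuesa_v g \<mu> L x0 (Suc k)))\<^sup>2" for z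
  proof -
    have "asuesa_phi f g \<mu> L x0 (Suc k) z =
        (1 - a) * (asuesa_phi f g \<mu> L x0 k v + (\<mu> / 2) * (norm (z - v))\<^sup>2)
        + a * (f y - (1 / (2 * \<mu>)) * (norm (g y))\<^sup>2 + (\<mu> / 2) * (norm (z - w))\<^sup>2)"
      using Suc.IH[of z] by (simp add: a_def v_def y_def w_def lower_model_def)
    also have "\<dots> = c + (\<mu> / 2) * (norm (z - asuesa_v g \<mu> L x0 (Suc k)))\<^sup>2"
      unfolding average_of_quadratics v_Suc c_def ..
    finally show ?thesis .
  qed
  then show ?case by simp
qed

lemma asuesa_v_minimises_phi:
  fixes f :: "'a::real_inner \<Rightarrow> real"
  assumes "0 \<le> \<mu>"
  shows "asuesa_phi f g \<mu> L x0 k (asuesa_v g \<mu> L x0 k) \<le> asuesa_phi f g \<mu> L x0 k x"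
  using assms by (subst (2) asuesa_phi_eq_quadratic) simp

lemma min_value_asuesa_phi:
  fixes f :: "'a::real_inner \<Rightarrow> real"
  assumes "0 \<le> \<mu>"
  shows "min_value (asuesa_phi f g \<mu> L x0 k) = asuesa_phi f g \<mu> L x0 k (asuesa_v g \<mu> L x0 k)"
  using assms by (intro min_value_eqI asuesa_v_minimises_phi)

text \<open>
  The minimum of the averaged quadratic in terms of \<open>y\<close> and \<open>v\<close> alone: at its own centre only
  the averaging gain is left, and there the squared distance between \<open>v\<close> and the centre of the
  new model is expanded.
\<close>

lemma asuesa_phi_min_Suc:
  fixes f :: "'a::real_inner \<Rightarrow> real" and g :: "'a \<Rightarrow> 'a" and \<mu> L :: real and x0 :: 'a and k :: nat
  assumes "0 < \<mu>"
  defines "a \<equiv> asuesa_alpha \<mu> L k"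
    and "v \<equiv> asuesa_v g \<mu> L x0 k"
    and "y \<equiv> asuesa_y g \<mu> L x0 k"
  shows "asuesa_phi f g \<mu> L x0 (Suc k) (asuesa_v g \<mu> L x0 (Suc k)) =
    (1 - a) * asuesa_phi f g \<mu> L x0 k v + a * f y - a\<^sup>2 / (2 * \<mu>) * (norm (g y))\<^sup>2
    + a * (1 - a) * (g y \<bullet> (v - y)) + a * (1 - a) * ((\<mu> / 2) * (norm (v - y))\<^sup>2)"
proof -
  define w where "w = long_step g \<mu> y"
  define u where "u = asuesa_v g \<mu> L x0 (Suc k)"
  have u: "u = (1 - a) *\<^sub>R v + a *\<^sub>R w"
    by (simp add: u_def asuesa_v_Suc a_def v_def w_def y_def)
  \<comment> \<open>The averaging gain gives back \<open>a(1 - a)\<close> of the loss \<open>a\<close> in the gradient term; \<open>a\<^sup>2\<close> remains.\<close>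
  have expand: "(1 - a) * p + a * (q - r * s) + a * (1 - a) * (d + i + r * s) =
      (1 - a) * p + a * q - a\<^sup>2 * r * s + a * (1 - a) * i + a * (1 - a) * d" for p q r s d i
    by (simp add: algebra_simps power2_eq_square)
  have "asuesa_phi f g \<mu> L x0 (Suc k) u =
      (1 - a) * (asuesa_phi f g \<mu> L x0 k v + (\<mu> / 2) * (norm (u - v))\<^sup>2)
      + a * (f y - (1 / (2 * \<mu>)) * (norm (g y))\<^sup>2 + (\<mu> / 2) * (norm (u - w))\<^sup>2)"
    using asuesa_phi_eq_quadratic[of f g \<mu> L x0 k u]
    by (simp add: a_def v_def y_def w_def lower_model_def)
  also have "\<dots> = (1 - a) * asuesa_phi f g \<mu> L x0 k v
      + a * (f y - (1 / (2 * \<mu>)) * (norm (g y))\<^sup>2)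
      + a * (1 - a) * ((\<mu> / 2) * (norm (v - w))\<^sup>2)"
    unfolding average_of_quadratics by (simp add: u)
  also have "(\<mu> / 2) * (norm (v - w))\<^sup>2 =
      (\<mu> / 2) * (norm (v - y))\<^sup>2 + g y \<bullet> (v - y) + (1 / (2 * \<mu>)) * (norm (g y))\<^sup>2"
    unfolding w_def by (rule norm_diff_long_step_squared[OF \<open>0 < \<mu>\<close>])
  finally show ?thesis
    unfolding expand u_def by simp
qed

text \<open>
  The step length \<open>1/L\<close> minimises the quadratic upper bound along \<open>-\<nabla>f(y)\<close>.
\<close>

lemma gradient_step_decrease:
  fixes f :: "'a::real_inner \<Rightarrow> real"
  assumes "0 < L"
    and smooth: "\<And>x y. f x \<le> f y + g y \<bullet> (x - y) + (L / 2) * (norm (x - y))\<^sup>2"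
  shows "f (y - (1 / L) *\<^sub>R g y) \<le> f y - (1 / (2 * L)) * (norm (g y))\<^sup>2"
proof -
  have "g y \<bullet> (y - (1 / L) *\<^sub>R g y - y) = - 2 * ((1 / (2 * L)) * (norm (g y))\<^sup>2)"
    by (simp add: power2_norm_eq_inner)
  moreover have "(L / 2) * (norm (y - (1 / L) *\<^sub>R g y - y))\<^sup>2 = (1 / (2 * L)) * (norm (g y))\<^sup>2"
    using \<open>0 < L\<close> by (simp add: power_divide) (simp add: field_simps power2_eq_square)
  ultimately show ?thesis
    using smooth[where x = "y - (1 / L) *\<^sub>R g y" and y = y] by linarith
qed

text \<open>
  The weight \<open>1/(1 + \<alpha>)\<close> places \<open>y\<close> so that its offsets to \<open>x\<close> and to \<open>v\<close> balance; this
  removes all first-order terms from the contraction.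
\<close>

lemma asuesa_y_balance:
  assumes "0 \<le> \<mu> / L"
  shows "(asuesa_x g \<mu> L x0 k - asuesa_y g \<mu> L x0 k)
    + asuesa_alpha \<mu> L k *\<^sub>R (asuesa_v g \<mu> L x0 k - asuesa_y g \<mu> L x0 k) = 0"
proof -
  define a where "a = asuesa_alpha \<mu> L k"
  define x where "x = asuesa_x g \<mu> L x0 k"
  define v where "v = asuesa_v g \<mu> L x0 k"
  define y where "y = asuesa_y g \<mu> L x0 k"
  have "0 \<le> a"
    using assms by (simp add: a_def asuesa_alpha_def)
  then have "(1 + a) * (1 / (1 + a)) = 1" "(1 + a) * (1 - 1 / (1 + a)) = a"
    by (simp_all add: field_simps)
  moreover have "(1 + a) *\<^sub>R y =
      ((1 + a) * (1 / (1 + a))) *\<^sub>R x + ((1 + a) * (1 - 1 / (1 + a))) *\<^sub>R v"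
    by (simp only: y_def x_def v_def a_def asuesa_y_def asuesa_beta_def
        scaleR_add_right scaleR_scaleR)
  ultimately have "(1 + a) *\<^sub>R y = x + a *\<^sub>R v"
    by simp
  then have "(x - y) + a *\<^sub>R (v - y) = 0"
    by (simp add: algebra_simps)
  then show ?thesis
    by (simp add: a_def x_def v_def y_def)
qed

text \<open>
  The loss \<open>a\<^sup>2/(2\<mu>) |\<nabla>f(y)|\<^sup>2\<close> in the model minimum is covered by the guaranteed gain
  \<open>|\<nabla>f(y)|\<^sup>2/(2L)\<close> of the gradient step as long as \<open>a\<^sup>2 \<le> \<mu>/L\<close>; the algorithm takes the largest
  such \<open>a\<close>, hence the best contraction factor that this argument can give.
\<close>

lemma gap_contraction:
  fixes f :: "'a::real_inner \<Rightarrow> real"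
  assumes "0 < \<mu>" "\<mu> \<le> L"
    and strongly_convex: "\<And>x y. f x \<ge> f y + g y \<bullet> (x - y) + (\<mu> / 2) * (norm (x - y))\<^sup>2"
    and smooth: "\<And>x y. f x \<le> f y + g y \<bullet> (x - y) + (L / 2) * (norm (x - y))\<^sup>2"
  shows "f (asuesa_x g \<mu> L x0 (Suc k)) - min_value (asuesa_phi f g \<mu> L x0 (Suc k))
    \<le> (1 - asuesa_alpha \<mu> L k) *
      (f (asuesa_x g \<mu> L x0 k) - min_value (asuesa_phi f g \<mu> L x0 k))"
proof -
  define a where "a = asuesa_alpha \<mu> L k"
  define x where "x = asuesa_x g \<mu> L x0 k"
  define v where "v = asuesa_v g \<mu> L x0 k"
  define y where "y = asuesa_y g \<mu> L x0 k"
  define m where "m = asuesa_phi f g \<mu> L x0 k v"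
  have "0 < L" using assms(1,2) by simp
  have a: "0 \<le> a" "a \<le> 1" and a_sq: "a\<^sup>2 = \<mu> / L"
    using assms(1,2) by (simp_all add: a_def asuesa_alpha_def)
  have step: "f (asuesa_x g \<mu> L x0 (Suc k)) \<le> f y - a\<^sup>2 / (2 * \<mu>) * (norm (g y))\<^sup>2"
    using gradient_step_decrease[where f = f and g = g and y = y, OF \<open>0 < L\<close> smooth] \<open>0 < \<mu>\<close>
    by (simp add: asuesa_x_Suc y_def a_sq field_simps)
  have "f y + g y \<bullet> (x - y) \<le> f x"
  proof -
    have "0 \<le> (\<mu> / 2) * (norm (x - y))\<^sup>2"
      using \<open>0 < \<mu>\<close> by simp
    then show ?thesis
      using strongly_convex[of y x] by linarith
  qed
  moreover have "g y \<bullet> (x - y) = - a * (g y \<bullet> (v - y))"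
  proof -
    have "g y \<bullet> ((x - y) + a *\<^sub>R (v - y)) = 0"
      using asuesa_y_balance[of \<mu> L g x0 k] \<open>0 < \<mu>\<close> \<open>0 < L\<close>
      by (simp add: x_def v_def y_def a_def)
    then show ?thesis by (simp add: inner_add_right)
  qed
  ultimately have "(1 - a) * (f y - a * (g y \<bullet> (v - y))) \<le> (1 - a) * f x"
    using a by (intro mult_left_mono) simp_all
  moreover have "f y - a\<^sup>2 / (2 * \<mu>) * (norm (g y))\<^sup>2
      - asuesa_phi f g \<mu> L x0 (Suc k) (asuesa_v g \<mu> L x0 (Suc k))
    \<le> (1 - a) * (f y - a * (g y \<bullet> (v - y))) - (1 - a) * m"
  proof -
    have "asuesa_phi f g \<mu> L x0 (Suc k) (asuesa_v g \<mu> L x0 (Suc k)) =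
      (1 - a) * m + a * f y - a\<^sup>2 / (2 * \<mu>) * (norm (g y))\<^sup>2
      + a * (1 - a) * (g y \<bullet> (v - y)) + a * (1 - a) * ((\<mu> / 2) * (norm (v - y))\<^sup>2)"
      unfolding a_def v_def y_def m_def by (rule asuesa_phi_min_Suc[OF \<open>0 < \<mu>\<close>])
    moreover have "0 \<le> a * (1 - a) * ((\<mu> / 2) * (norm (v - y))\<^sup>2)"
      using a \<open>0 < \<mu>\<close> by simp
    moreover have "(1 - a) * (f y - a * (g y \<bullet> (v - y))) =
        f y - a * f y - a * (1 - a) * (g y \<bullet> (v - y))"
      by (simp add: left_diff_distrib right_diff_distrib)
    ultimately show ?thesis by linarith
  qed
  ultimately have "f y - a\<^sup>2 / (2 * \<mu>) * (norm (g y))\<^sup>2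
      - asuesa_phi f g \<mu> L x0 (Suc k) (asuesa_v g \<mu> L x0 (Suc k)) \<le> (1 - a) * (f x - m)"
    by (simp add: right_diff_distrib[of "1 - a" "f x" m])
  with step have "f (asuesa_x g \<mu> L x0 (Suc k))
      - asuesa_phi f g \<mu> L x0 (Suc k) (asuesa_v g \<mu> L x0 (Suc k)) \<le> (1 - a) * (f x - m)"
    by linarith
  then show ?thesis
    unfolding min_value_asuesa_phi[OF less_imp_le[OF \<open>0 < \<mu>\<close>]] a_def x_def v_def m_def .
qed

lemma underestimate_sequence_asuesa:
  fixes f :: "'a::real_inner \<Rightarrow> real"
  assumes "0 < \<mu>" "\<mu> < L"
    and strongly_convex: "\<And>x y. f x \<ge> f y + g y \<bullet> (x - y) + (\<mu> / 2) * (norm (x - y))\<^sup>2"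
    and smooth: "\<And>x y. f x \<le> f y + g y \<bullet> (x - y) + (L / 2) * (norm (x - y))\<^sup>2"
  shows "underestimate_sequence f (asuesa_x g \<mu> L x0) (asuesa_phi f g \<mu> L x0) (asuesa_alpha \<mu> L)"
  unfolding underestimate_sequence_def
proof (intro conjI allI)
  fix k z
  show "attains_min (asuesa_phi f g \<mu> L x0 k)"
    using \<open>0 < \<mu>\<close> asuesa_v_minimises_phi unfolding attains_min_def by (metis less_imp_le)
  show "0 < asuesa_alpha \<mu> L k" "asuesa_alpha \<mu> L k < 1"
    using assms(1,2) by (simp_all add: asuesa_alpha_def)
  show "asuesa_phi f g \<mu> L x0 k z \<le> f z"
    using assms by (intro asuesa_phi_le) simp_all
  show "f (asuesa_x g \<mu> L x0 (Suc k)) - min_value (asuesa_phi f g \<mu> L x0 (Suc k))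
    \<le> (1 - asuesa_alpha \<mu> L k) *
      (f (asuesa_x g \<mu> L x0 k) - min_value (asuesa_phi f g \<mu> L x0 k))"
    using assms by (intro gap_contraction) simp_all
qed

lemma underestimate_sequence_linear_rate:
  assumes "underestimate_sequence F x \<phi> (\<lambda>_. a)"
  shows "F (x k) - min_value (\<phi> k) \<le> (1 - a) ^ k * (F (x 0) - min_value (\<phi> 0))"
proof (induction k)
  case 0
  show ?case by simp
next
  case (Suc k)
  have "F (x (Suc k)) - min_value (\<phi> (Suc k)) \<le> (1 - a) * (F (x k) - min_value (\<phi> k))"
    using assms by (simp add: underestimate_sequence_def)
  also have "\<dots> \<le> (1 - a) * ((1 - a) ^ k * (F (x 0) - min_value (\<phi> 0)))"
    using assms Suc.IH by (intro mult_left_mono) (auto simp: underestimate_sequence_def)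
  finally show ?case by (simp add: mult.assoc)
qed

theorem corollary4:
  fixes f :: "real ^ 'n \<Rightarrow> real" and g :: "real ^ 'n \<Rightarrow> real ^ 'n"
    and \<mu> L :: real and x0 :: "real ^ 'n"
  assumes "0 < \<mu>" and "\<mu> < L"
    and grad: "\<And>y. GDERIV f y :> g y"
    and C1: "continuous_on UNIV g"
    and strongly_convex: "\<And>x y. f x \<ge> f y + g y \<bullet> (x - y) + (\<mu> / 2) * (norm (x - y))\<^sup>2"
    and smooth: "\<And>x y. f x \<le> f y + g y \<bullet> (x - y) + (L / 2) * (norm (x - y))\<^sup>2"
  shows "underestimate_sequence f (asuesa_x g \<mu> L x0) (asuesa_phi f g \<mu> L x0) (asuesa_alpha \<mu> L) \<and>
    (\<forall>k. f (asuesa_x g \<mu> L x0 k) - min_value (asuesa_phi f g \<mu> L x0 k)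
          \<le> (1 - sqrt (\<mu> / L)) ^ k * (f x0 - min_value (asuesa_phi f g \<mu> L x0 0)))"
proof -
  have ues: "underestimate_sequence f (asuesa_x g \<mu> L x0) (asuesa_phi f g \<mu> L x0) (asuesa_alpha \<mu> L)"
    using \<open>0 < \<mu>\<close> \<open>\<mu> < L\<close> strongly_convex smooth by (rule underestimate_sequence_asuesa)
  have "asuesa_alpha \<mu> L = (\<lambda>_. sqrt (\<mu> / L))"
    by (simp add: asuesa_alpha_def fun_eq_iff)
  with ues have "underestimate_sequence f (asuesa_x g \<mu> L x0) (asuesa_phi f g \<mu> L x0)
      (\<lambda>_. sqrt (\<mu> / L))"
    by simp
  from underestimate_sequence_linear_rate[OF this] ues show ?thesis
    by (simp only: asuesa_x_0) simp
qed

end
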